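(* Let $n$ be a nonnegative integer and let $(\mathcal{F},\mathcal{G})$ be a cross-Sperner pair of families of subsets of $[n]$ such that neither $\mathcal{F}$ nor $\mathcal{G}$ is empty. Then $n\geq 2$ and \[|\mathcal{F}|+|\mathcal{G}| \leq 2^n-2^{\lceil n/2 \rceil} - 2^{\lfloor n/2 \rfloor}+2.\] Furthermore, for $n \neq 3$, we have equality if and only if one of $\mathcal{F}$ or $\mathcal{G}$ consists of exactly one set $A$ of size $\lceil \frac{n}{2} \rceil$ or $\lfloor \frac{n}{2} \rfloor$ and the other family consists of all subsets of $[n]$ that are neither supersets nor subsets of $A$.
   Context: $[n]=\{1,\ldots,n\}$ (so $[0]=\emptyset$). For families $\mathcal{F}$ and $\mathcal{G}$ of subsets of $[n]$, the pair $(\mathcal{F},\mathcal{G})$ is cross-Sperner if $F \nsubseteq G$ and $G \nsubseteq F$ for all $F \in \mathcal{F}$ and $G \in \mathcal{G}$. Subsets and supersets of $A$ are not required to be proper (so $A$ is both a subset and a superset of itself). *)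

theory Defs
  imports Complex_Main
begin

definition cross_sperner :: "'a set set \<Rightarrow> 'a set set \<Rightarrow> bool" where
  "cross_sperner F G \<longleftrightarrow> (\<forall>A\<in>F. \<forall>B\<in>G. \<not> A \<subseteq> B \<and> \<not> B \<subseteq> A)"

definition incomparable_subsets :: "'a set \<Rightarrow> 'a set \<Rightarrow> 'a set set" where
  "incomparable_subsets X A = {B. B \<subseteq> X \<and> \<not> A \<subseteq> B \<and> \<not> B \<subseteq> A}"

end

theory Submission
  imports Defs
begin

text \<open>
  Write \<open>N = 2 ^ n\<close>. If one family is a single set \<open>A\<close>, the other one lies among the sets
  incomparable to \<open>A\<close>, of which there are \<open>N - 2 ^ a - 2 ^ (n - a) + 1\<close> for \<open>a = card A\<close>; this
  is largest exactly when \<open>a\<close> is one of the two roundings of \<open>n / 2\<close>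
  (lemma \<open>singleton_pair_bound\<close>).

  If both families have at least two members, the pair is smaller still, by correlation. Let \<open>c\<close>
  and \<open>d\<close> be the sizes of the up-closure and the down-closure of \<open>G\<close>. An up-set and a down-set are
  negatively correlated (Harris and Kleitman; lemma \<open>harris_kleitman\<close>), and \<open>G\<close> lies in the
  intersection of its two closures, so \<open>N * card G \<le> c * d\<close>. The up-closure of \<open>G\<close> is disjoint
  from the down-closure of \<open>F\<close> and vice versa, so likewise
  \<open>N * card F \<le> (N - c) * (N - d)\<close>. Hence
  \<open>N * (card F + card G) \<le> c * d + (N - c) * (N - d)\<close>, where both products on the right are at
  least \<open>2 * N\<close>. By the arithmetic-geometric mean inequality the right-hand side is then at most the
  larger of \<open>N\<^sup>2 / 2\<close> and its value at \<open>c = d = sqrt (2 * N)\<close>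
  (lemma \<open>products_of_complements_bound\<close>), that is,
  \<open>card F + card G\<close> is at most \<open>N / 2\<close> or at most \<open>N - 2 * sqrt (2 * N) + 4\<close>.
  Both bounds are below the extremal value for \<open>n \<ge> 4\<close> and equal to it for \<open>n = 3\<close>; for
  \<open>n = 2\<close> they are below \<open>3\<close>, so that no such pair exists.
\<close>

section \<open>Correlation of up-sets and down-sets\<close>

text \<open>Splitting along a new point \<open>x\<close> lets the induction over the ground set run: a family is
  replaced by its two traces, the members without \<open>x\<close> and the members with \<open>x\<close>, the latter with
  \<open>x\<close> removed.\<close>

lemma card_split_point:
  assumes "finite X" "x \<notin> X" "H \<subseteq> Pow (insert x X)"
  shows "card H = card {S \<in> Pow X. S \<in> H} + card {S \<in> Pow X. insert x S \<in> H}"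
proof -
  have "H = {S \<in> Pow X. S \<in> H} \<union> insert x ` {S \<in> Pow X. insert x S \<in> H}" (is "_ = ?H0 \<union> ?H1")
  proof (intro equalityI subsetI)
    fix S assume S: "S \<in> H"
    show "S \<in> ?H0 \<union> ?H1"
    proof (cases "x \<in> S")
      case True
      then have "S = insert x (S - {x})" by blast
      moreover have "S - {x} \<in> Pow X" using S assms(3) by blast
      ultimately show ?thesis using S by (metis (mono_tags, lifting) UnI2 image_eqI mem_Collect_eq)
    next
      case False
      then show ?thesis using S assms(3) by blast
    qed
  qed auto
  moreover have "?H0 \<inter> ?H1 = {}" using assms(2) by auto
  moreover have "inj_on (insert x) {S \<in> Pow X. insert x S \<in> H}"
    using assms(2) by (auto simp: inj_on_def)
  moreover have "finite ?H0" "finite ?H1" using assms(1) by auto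
  ultimately show ?thesis by (metis (no_types, lifting) card_Un_disjoint card_image)
qed

text \<open>Induction over the ground set. With the sizes \<open>u0 \<le> u1\<close> of the traces of the up-set and
  \<open>d1 \<le> d0\<close> of those of the down-set, the step is Chebyshev's inequality
  \<open>2 * (u0 * d0 + u1 * d1) \<le> (u0 + u1) * (d0 + d1)\<close>.\<close>

lemma harris_kleitman:
  assumes "finite X" "U \<subseteq> Pow X" "D \<subseteq> Pow X"
    and "\<And>S T. S \<in> U \<Longrightarrow> S \<subseteq> T \<Longrightarrow> T \<subseteq> X \<Longrightarrow> T \<in> U"
    and "\<And>S T. S \<in> D \<Longrightarrow> T \<subseteq> S \<Longrightarrow> T \<in> D"
  shows "2 ^ card X * card (U \<inter> D) \<le> card U * card D"
  using assms
proof (induction X arbitrary: U D rule: finite_induct)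
  case empty
  then have "U = {} \<or> U = {{}}" "D = {} \<or> D = {{}}" by auto
  then show ?case by auto
next
  case (insert x X)
  define U0 U1 D0 D1 where
    "U0 = {S \<in> Pow X. S \<in> U}" and "U1 = {S \<in> Pow X. insert x S \<in> U}" and
    "D0 = {S \<in> Pow X. S \<in> D}" and "D1 = {S \<in> Pow X. insert x S \<in> D}"
  note defs = U0_def U1_def D0_def D1_def
  note up = insert.prems(3) and down = insert.prems(4)
  have fin: "finite U1" "finite D0" using insert.hyps by (auto simp: defs)
  have cU: "card U = card U0 + card U1"
    unfolding defs using insert.hyps insert.prems(1) by (rule card_split_point)
  have cD: "card D = card D0 + card D1"
    unfolding defs using insert.hyps insert.prems(2) by (rule card_split_point)
  have "U \<inter> D \<subseteq> Pow (insert x X)" using insert.prems(1) by blast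
  note card_split_point[OF insert.hyps this]
  moreover have "{S \<in> Pow X. S \<in> U \<inter> D} = U0 \<inter> D0" "{S \<in> Pow X. insert x S \<in> U \<inter> D} = U1 \<inter> D1"
    by (auto simp: defs)
  ultimately have cI: "card (U \<inter> D) = card (U0 \<inter> D0) + card (U1 \<inter> D1)" by simp
  have "insert x S \<in> U" if "S \<in> U" "S \<subseteq> X" for S
    using up[OF that(1), of "insert x S"] that(2) by blast
  then have "U0 \<subseteq> U1" by (auto simp: defs)
  then have u: "card U0 \<le> card U1" using fin by (simp add: card_mono)
  have "D1 \<subseteq> D0" unfolding defs using down by blast
  then have d: "card D1 \<le> card D0" using fin by (simp add: card_mono)
  have IH0: "2 ^ card X * card (U0 \<inter> D0) \<le> card U0 * card D0"
  proof (rule insert.IH)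
    show "\<And>S T. S \<in> U0 \<Longrightarrow> S \<subseteq> T \<Longrightarrow> T \<subseteq> X \<Longrightarrow> T \<in> U0"
      unfolding defs using up by blast
    show "\<And>S T. S \<in> D0 \<Longrightarrow> T \<subseteq> S \<Longrightarrow> T \<in> D0"
      unfolding defs using down by blast
  qed (auto simp: defs)
  have IH1: "2 ^ card X * card (U1 \<inter> D1) \<le> card U1 * card D1"
  proof (rule insert.IH)
    show "\<And>S T. S \<in> U1 \<Longrightarrow> S \<subseteq> T \<Longrightarrow> T \<subseteq> X \<Longrightarrow> T \<in> U1"
    proof -
      fix S T assume "S \<in> U1" "S \<subseteq> T" "T \<subseteq> X"
      then show "T \<in> U1" using up[of "insert x S" "insert x T"] unfolding defs by blast
    qed
    show "\<And>S T. S \<in> D1 \<Longrightarrow> T \<subseteq> S \<Longrightarrow> T \<in> D1"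
    proof -
      fix S T assume "S \<in> D1" "T \<subseteq> S"
      then show "T \<in> D1" using down[of "insert x S" "insert x T"] unfolding defs by blast
    qed
  qed (auto simp: defs)
  obtain p where p: "card U1 = card U0 + p" using u le_Suc_ex by blast
  obtain q where q: "card D0 = card D1 + q" using d le_Suc_ex by blast
  have "2 ^ card (insert x X) * card (U \<inter> D)
      = 2 * (2 ^ card X * card (U0 \<inter> D0) + 2 ^ card X * card (U1 \<inter> D1))"
    using insert.hyps by (simp add: cI algebra_simps)
  also have "\<dots> \<le> 2 * (card U0 * card D0 + card U1 * card D1)"
    using IH0 IH1 by simp
  also have "\<dots> \<le> card U * card D"
    by (simp add: cU cD p q algebra_simps)
  finally show ?case .
qed

definition up_closure :: "'a set \<Rightarrow> 'a set set \<Rightarrow> 'a set set" where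
  "up_closure X H = {S. S \<subseteq> X \<and> (\<exists>A\<in>H. A \<subseteq> S)}"

definition down_closure :: "'a set \<Rightarrow> 'a set set \<Rightarrow> 'a set set" where
  "down_closure X H = {S. S \<subseteq> X \<and> (\<exists>A\<in>H. S \<subseteq> A)}"

lemma card_le_closures:
  assumes "finite X" "H \<subseteq> Pow X"
  shows "2 ^ card X * card H \<le> card (up_closure X H) * card (down_closure X H)"
proof -
  have "finite (up_closure X H \<inter> down_closure X H)"
    using assms(1) by (simp add: up_closure_def)
  moreover have "H \<subseteq> up_closure X H \<inter> down_closure X H"
    using assms(2) by (auto simp: up_closure_def down_closure_def)
  ultimately have "card H \<le> card (up_closure X H \<inter> down_closure X H)"
    by (rule card_mono)
  then have "2 ^ card X * card H \<le> 2 ^ card X * card (up_closure X H \<inter> down_closure X H)"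
    by simp
  also have "\<dots> \<le> card (up_closure X H) * card (down_closure X H)"
    using assms(1) by (rule harris_kleitman) (unfold up_closure_def down_closure_def, blast+)
  finally show ?thesis .
qed

text \<open>A set above a member of \<open>F\<close> and below a member of \<open>G\<close> would make the two members
  comparable.\<close>

lemma cross_sperner_closures:
  assumes "finite X" "cross_sperner F G"
  shows "card (up_closure X F) + card (down_closure X G) \<le> 2 ^ card X"
proof -
  have False if up: "S \<in> up_closure X F" and down: "S \<in> down_closure X G" for S
  proof -
    from up obtain A where "A \<in> F" "A \<subseteq> S" by (auto simp: up_closure_def)
    moreover from down obtain B where "B \<in> G" "S \<subseteq> B" by (auto simp: down_closure_def)
    ultimately show False using assms(2) unfolding cross_sperner_def by (meson order_trans)
  qed
  then have disjoint: "up_closure X F \<inter> down_closure X G = {}" by blast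
  have "finite (up_closure X F)" "finite (down_closure X G)"
    using assms(1) by (auto simp: up_closure_def down_closure_def)
  from card_Un_disjoint[OF this disjoint]
  have "card (up_closure X F) + card (down_closure X G)
      = card (up_closure X F \<union> down_closure X G)"
    by (rule sym)
  also have "\<dots> \<le> card (Pow X)"
    using assms(1) by (intro card_mono) (auto simp: up_closure_def down_closure_def)
  finally show ?thesis using assms(1) by (simp add: card_Pow)
qed

lemma cross_sperner_commute: "cross_sperner F G \<longleftrightarrow> cross_sperner G F"
  by (auto simp: cross_sperner_def)

section \<open>Pairs of families with at least two members\<close>

text \<open>The left-hand side equals \<open>N\<^sup>2 / 2 + 2 * (N/2 - c) * (N/2 - d)\<close>. If the last two factors have
  opposite signs, the first alternative holds. Otherwise, passing to \<open>N - c\<close> and \<open>N - d\<close> if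
  necessary, both are nonnegative, and their product is at most \<open>(N/2 - (c + d)/2)\<^sup>2\<close>, where
  \<open>(c + d)/2 \<ge> t\<close>.\<close>

lemma products_of_complements_bound:
  fixes N c d t :: real
  assumes "0 \<le> c" "c \<le> N" "0 \<le> d" "d \<le> N"
    and "t\<^sup>2 \<le> c * d" "t\<^sup>2 \<le> (N - c) * (N - d)"
  shows "c * d + (N - c) * (N - d) \<le> N\<^sup>2 / 2 \<or> c * d + (N - c) * (N - d) \<le> t\<^sup>2 + (N - t)\<^sup>2"
proof -
  have both_small: "c * d + (N - c) * (N - d) \<le> t\<^sup>2 + (N - t)\<^sup>2"
    if "0 \<le> c" "c \<le> N / 2" "0 \<le> d" "d \<le> N / 2" "t\<^sup>2 \<le> c * d" for c d
  proof -
    have "4 * (c * d) \<le> (c + d)\<^sup>2"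
      using zero_le_power2[of "c - d"] by (simp add: power2_eq_square algebra_simps)
    then have "t\<^sup>2 \<le> ((c + d) / 2)\<^sup>2" using that(5) by (simp add: power_divide)
    then have t: "t \<le> (c + d) / 2" by (rule power2_le_imp_le) (use that in simp)
    have "4 * ((N / 2 - c) * (N / 2 - d)) \<le> (N - (c + d))\<^sup>2"
      using zero_le_power2[of "c - d"] by (simp add: power2_eq_square algebra_simps)
    also have "\<dots> \<le> (N - 2 * t)\<^sup>2"
      by (rule power_mono) (use t that in auto)
    finally show ?thesis by (simp add: power2_eq_square algebra_simps)
  qed
  consider "c \<le> N / 2" "d \<le> N / 2" | "N / 2 \<le> c" "N / 2 \<le> d"
    | "(N / 2 - c) * (N / 2 - d) \<le> 0"
    by (smt (verit) mult_nonneg_nonpos mult_nonpos_nonneg)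
  then show ?thesis
  proof cases
    case 1
    then show ?thesis using both_small assms by blast
  next
    case 2
    then show ?thesis using both_small[of "N - c" "N - d"] assms by (simp add: algebra_simps)
  next
    case 3
    then show ?thesis by (simp add: power2_eq_square algebra_simps)
  qed
qed

lemma large_cross_sperner_pair:
  assumes "finite X" "F \<subseteq> Pow X" "G \<subseteq> Pow X" "cross_sperner F G"
    and "2 \<le> card F" "2 \<le> card G"
  defines "N \<equiv> 2 ^ card X :: real"
  shows "card F + card G \<le> N / 2 \<or> card F + card G \<le> N - 2 * sqrt (2 * N) + 4"
proof -
  define a b c d where
    "a = real (card (up_closure X F))" and "b = real (card (down_closure X F))" and
    "c = real (card (up_closure X G))" and "d = real (card (down_closure X G))"
  note defs = a_def b_def c_def d_def
  have N: "N > 0" "N = real (2 ^ card X)" by (auto simp: N_def)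
  have f: "N * card F \<le> a * b"
    using card_le_closures[OF assms(1,2)] unfolding N(2) defs of_nat_mult[symmetric] of_nat_le_iff .
  have g: "N * card G \<le> c * d"
    using card_le_closures[OF assms(1,3)] unfolding N(2) defs of_nat_mult[symmetric] of_nat_le_iff .
  have ad: "a + d \<le> N"
    using cross_sperner_closures[OF assms(1,4)]
    unfolding N(2) defs of_nat_add[symmetric] of_nat_le_iff .
  have "cross_sperner G F" using assms(4) by (simp add: cross_sperner_commute)
  from cross_sperner_closures[OF assms(1) this] have cb: "c + b \<le> N"
    unfolding N(2) defs of_nat_add[symmetric] of_nat_le_iff .
  have nonneg: "0 \<le> a" "0 \<le> b" "0 \<le> c" "0 \<le> d" by (auto simp: defs)
  have "a * b \<le> (N - d) * (N - c)" using ad cb nonneg by (intro mult_mono) auto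
  then have f': "N * card F \<le> (N - c) * (N - d)" using f by (simp add: mult.commute)
  have two: "2 * N \<le> N * card F" "2 * N \<le> N * card G" using N(1) assms(5,6) by auto
  define t where "t = sqrt (2 * N)"
  have t2: "t\<^sup>2 = 2 * N" unfolding t_def using N(1) by simp
  have "c * d + (N - c) * (N - d) \<le> N\<^sup>2 / 2 \<or> c * d + (N - c) * (N - d) \<le> t\<^sup>2 + (N - t)\<^sup>2"
    using nonneg ad cb two f' g t2 by (intro products_of_complements_bound) linarith+
  moreover have "t\<^sup>2 + (N - t)\<^sup>2 = N * (N - 2 * t + 4)"
    using t2 by (simp add: power2_eq_square algebra_simps)
  moreover have "N\<^sup>2 / 2 = N * (N / 2)" by (simp add: power2_eq_square)
  moreover have "N * (card F + card G) \<le> c * d + (N - c) * (N - d)"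
    using f' g by (simp add: algebra_simps)
  ultimately have "N * (card F + card G) \<le> N * (N / 2)
      \<or> N * (card F + card G) \<le> N * (N - 2 * t + 4)"
    by linarith
  then show ?thesis unfolding t_def mult_le_cancel_left_pos[OF N(1)] .
qed

text \<open>The bounds of the previous lemma against the extremal value, for even and odd \<open>n\<close>. At
  \<open>n = 2\<close> the hypotheses are contradictory: both bounds are less than \<open>4\<close>. At \<open>n = 3\<close> both
  bounds equal the extremal value \<open>4\<close>.\<close>

lemma large_pair_below_extremal:
  fixes n k :: nat
  assumes "2 \<le> n" "4 \<le> k"
    and "k \<le> (2 ^ n :: real) / 2 \<or> k \<le> 2 ^ n - 2 * sqrt (2 * 2 ^ n) + 4"
  shows "k + 2 ^ (n div 2) + 2 ^ (n - n div 2) \<le> 2 ^ n + (2::nat)"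
    and "n \<noteq> 3 \<Longrightarrow> k + 2 ^ (n div 2) + 2 ^ (n - n div 2) < 2 ^ n + (2::nat)"
proof -
  have "k + 2 ^ (n div 2) + 2 ^ (n - n div 2) \<le> 2 ^ n + (2::nat)
     \<and> (n \<noteq> 3 \<longrightarrow> k + 2 ^ (n div 2) + 2 ^ (n - n div 2) < 2 ^ n + (2::nat))"
  proof (cases "even n")
    case True
    then obtain m where m: "n = 2 * m" by (elim evenE)
    define y :: real where "y = 2 ^ m"
    have N: "2 ^ n = y\<^sup>2" by (simp add: m y_def power_mult[symmetric] mult.commute)
    have "y > 0" by (simp add: y_def)
    then have s: "sqrt (2 * 2 ^ n) = sqrt 2 * y" by (simp add: N real_sqrt_mult)
    \<comment> \<open>Any lower bound for \<open>sqrt 2\<close> above \<open>5/4\<close> settles \<open>y \<ge> 4\<close>: \<open>2 * (r - 1) * y > 2\<close> is needed.\<close>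
    have r: "(7/5::real) \<le> sqrt 2" by (rule real_le_rsqrt) (simp add: power2_eq_square)
    then have "7/5 * y \<le> sqrt (2 * 2 ^ n)" unfolding s using \<open>y > 0\<close> by simp
    then have k: "k \<le> y\<^sup>2 / 2 \<or> k \<le> y\<^sup>2 - 14/5 * y + 4" using assms(3) unfolding N by linarith
    have "m \<noteq> 1" using k assms(2) by (auto simp: y_def power2_eq_square)
    then have "m \<ge> 2" using assms(1) m by linarith
    then have "y \<ge> 2 ^ 2" unfolding y_def by (intro power_increasing) auto
    then have y: "y \<ge> 4" by simp
    then have "4 * y \<le> y\<^sup>2" by (simp add: power2_eq_square)
    then have "k + y + y < y\<^sup>2 + 2" using k y by linarith
    moreover have "real (k + 2 ^ (n div 2) + 2 ^ (n - n div 2)) = k + y + y"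
      by (simp add: m y_def)
    moreover have "real (2 ^ n + 2) = y\<^sup>2 + 2" using N by simp
    ultimately have "real (k + 2 ^ (n div 2) + 2 ^ (n - n div 2)) < real (2 ^ n + 2)" by simp
    then show ?thesis unfolding of_nat_less_iff by simp
  next
    case False
    then obtain m where m: "n = 2 * m + 1" by (elim oddE)
    define y :: real where "y = 2 ^ m"
    have N: "2 ^ n = 2 * y\<^sup>2" by (simp add: m y_def power_mult[symmetric] mult.commute)
    have "y > 0" by (simp add: y_def)
    have "2 * 2 ^ n = (2 * y)\<^sup>2" by (simp add: N power2_eq_square)
    then have "sqrt (2 * 2 ^ n) = 2 * y" using \<open>y > 0\<close> by (metis abs_of_pos mult_pos_pos real_sqrt_abs zero_less_numeral)
    then have k: "k \<le> y\<^sup>2 \<or> k \<le> 2 * y\<^sup>2 - 4 * y + 4" using assms(3) unfolding N by linarith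
    have e1: "real (k + 2 ^ (n div 2) + 2 ^ (n - n div 2)) = k + 3 * y"
      by (simp add: m y_def)
    have e2: "real (2 ^ n + 2) = 2 * y\<^sup>2 + 2" using N by simp
    show ?thesis
    proof (cases "m = 1")
      case True
      then show ?thesis using k m by (auto simp: y_def power2_eq_square)
    next
      case False
      then have "m \<ge> 2" using assms(1) m by linarith
      then have "y \<ge> 2 ^ 2" unfolding y_def by (intro power_increasing) auto
      then have y: "y \<ge> 4" by simp
      then have "4 * y \<le> y\<^sup>2" by (simp add: power2_eq_square)
      then have "k + 3 * y < 2 * y\<^sup>2 + 2" using k y by linarith
      then have "real (k + 2 ^ (n div 2) + 2 ^ (n - n div 2)) < real (2 ^ n + 2)"
        using e1 e2 by simp
      then show ?thesis unfolding of_nat_less_iff by simp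
    qed
  qed
  then show "k + 2 ^ (n div 2) + 2 ^ (n - n div 2) \<le> 2 ^ n + (2::nat)"
    and "n \<noteq> 3 \<Longrightarrow> k + 2 ^ (n div 2) + 2 ^ (n - n div 2) < 2 ^ n + (2::nat)"
    by auto
qed

section \<open>Pairs with a single set\<close>

lemma card_incomparable_subsets:
  assumes "finite X" "A \<subseteq> X"
  shows "card (incomparable_subsets X A) + 2 ^ card A + 2 ^ (card X - card A) = 2 ^ card X + 1"
proof -
  let ?I = "incomparable_subsets X A" and ?U = "{S. A \<subseteq> S \<and> S \<subseteq> X}"
  have finA: "finite A" using assms finite_subset by blast
  have "bij_betw (\<lambda>S. S \<union> A) (Pow (X - A)) ?U"
    by (rule bij_betw_byWitness[where f' = "\<lambda>S. S - A"]) (use assms(2) in blast)+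
  then have U: "card ?U = 2 ^ (card X - card A)"
    using assms finA by (simp add: bij_betw_same_card[symmetric] card_Pow card_Diff_subset)
  have fin: "finite ?I" "finite ?U" "finite (Pow A)"
    using assms(1) finA by (auto simp: incomparable_subsets_def intro: finite_subset[of _ "Pow X"])
  have "card (?U \<union> Pow A) + card (?U \<inter> Pow A) = card ?U + card (Pow A)"
    using card_Un_Int[OF fin(2,3)] by simp
  moreover have "?U \<inter> Pow A = {A}" using assms(2) by auto
  ultimately have "card (?U \<union> Pow A) + 1 = 2 ^ (card X - card A) + 2 ^ card A"
    using U finA by (simp add: card_Pow)
  moreover have "card (?I \<union> (?U \<union> Pow A)) = card ?I + card (?U \<union> Pow A)"
    using fin by (intro card_Un_disjoint) (auto simp: incomparable_subsets_def)
  moreover have "?I \<union> (?U \<union> Pow A) = Pow X"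
    using assms(2) by (auto simp: incomparable_subsets_def)
  ultimately show ?thesis using assms(1) by (simp add: card_Pow)
qed

text \<open>Moving an unbalanced split \<open>n = a + (n - a)\<close> towards the middle at least halves the larger
  of the two powers, so that power alone is at least the balanced sum; the other one makes the
  inequality strict.\<close>

lemma balanced_powers_strict:
  fixes n a :: nat
  assumes "a \<le> n" "a \<noteq> n div 2" "a \<noteq> n - n div 2"
  shows "2 ^ (n div 2) + 2 ^ (n - n div 2) < 2 ^ a + (2::nat) ^ (n - a)"
proof -
  have smaller: "2 ^ (n div 2) + 2 ^ (n - n div 2) < 2 ^ a + (2::nat) ^ (n - a)"
    if "a < n div 2" for a
  proof -
    have "(2::nat) ^ (n div 2) \<le> 2 ^ (n - n div 2)" by (rule power_increasing) auto
    moreover have "(2::nat) ^ Suc (n - n div 2) \<le> 2 ^ (n - a)"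
      by (rule power_increasing) (use that in auto)
    moreover have "(0::nat) < 2 ^ a" by simp
    ultimately show ?thesis unfolding power_Suc by linarith
  qed
  show ?thesis
  proof (cases "a < n div 2")
    case True
    then show ?thesis by (rule smaller)
  next
    case False
    then have "n - a < n div 2" using assms by linarith
    from smaller[OF this] show ?thesis using assms(1) by (simp add: add.commute)
  qed
qed

lemma singleton_pair_bound:
  assumes "finite X" "A \<subseteq> X" "G \<subseteq> incomparable_subsets X A"
  defines "n \<equiv> card X"
  shows "1 + card G + 2 ^ (n div 2) + 2 ^ (n - n div 2) \<le> 2 ^ n + 2"
    and "1 + card G + 2 ^ (n div 2) + 2 ^ (n - n div 2) = 2 ^ n + 2
      \<longleftrightarrow> (card A = n - n div 2 \<or> card A = n div 2) \<and> G = incomparable_subsets X A"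
proof -
  have an: "card A \<le> n" unfolding n_def using assms(1,2) by (rule card_mono)
  have fin: "finite (incomparable_subsets X A)"
    using assms(1) by (simp add: incomparable_subsets_def)
  have g: "card G \<le> card (incomparable_subsets X A)"
    using fin assms(3) by (rule card_mono)
  have g_eq: "G = incomparable_subsets X A" if "card G = card (incomparable_subsets X A)"
    using fin assms(3) that by (rule card_subset_eq)
  have I: "card (incomparable_subsets X A) + 2 ^ card A + 2 ^ (n - card A) = 2 ^ n + 1"
    unfolding n_def by (rule card_incomparable_subsets[OF assms(1,2)])
  show "1 + card G + 2 ^ (n div 2) + 2 ^ (n - n div 2) \<le> 2 ^ n + 2"
    and "1 + card G + 2 ^ (n div 2) + 2 ^ (n - n div 2) = 2 ^ n + 2
      \<longleftrightarrow> (card A = n - n div 2 \<or> card A = n div 2) \<and> G = incomparable_subsets X A"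
  proof -
    have "1 + card G + 2 ^ (n div 2) + 2 ^ (n - n div 2) \<le> 2 ^ n + 2 \<and>
      (1 + card G + 2 ^ (n div 2) + 2 ^ (n - n div 2) = 2 ^ n + 2
      \<longleftrightarrow> (card A = n - n div 2 \<or> card A = n div 2) \<and> G = incomparable_subsets X A)"
    proof (cases "card A = n - n div 2 \<or> card A = n div 2")
      case True
      then have "2 ^ card A + 2 ^ (n - card A) = 2 ^ (n div 2) + (2::nat) ^ (n - n div 2)"
        by auto
      then show ?thesis using I g g_eq True by auto
    next
      case False
      then show ?thesis using balanced_powers_strict[of "card A" n] an I g by auto
    qed
    then show "1 + card G + 2 ^ (n div 2) + 2 ^ (n - n div 2) \<le> 2 ^ n + 2"
      and "1 + card G + 2 ^ (n div 2) + 2 ^ (n - n div 2) = 2 ^ n + 2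
        \<longleftrightarrow> (card A = n - n div 2 \<or> card A = n div 2) \<and> G = incomparable_subsets X A"
      by blast+
  qed
qed

section \<open>The bound and its equality cases\<close>

lemma cross_sperner_ground_set:
  assumes "finite X" "F \<subseteq> Pow X" "G \<subseteq> Pow X" "cross_sperner F G" "F \<noteq> {}" "G \<noteq> {}"
  shows "2 \<le> card X"
proof -
  obtain A B where AB: "A \<in> F" "B \<in> G" using assms(5,6) by blast
  then have "\<not> A \<subseteq> B" "\<not> B \<subseteq> A" using assms(4) by (auto simp: cross_sperner_def)
  then obtain x y where "x \<in> A" "x \<notin> B" "y \<in> B" "y \<notin> A" by blast
  then have "{x, y} \<subseteq> X" "x \<noteq> y" using AB assms(2,3) by auto
  then show ?thesis using card_mono[OF assms(1), of "{x, y}"] by simp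
qed

lemma cross_sperner_singleton:
  assumes "cross_sperner {A} G" "G \<subseteq> Pow X"
  shows "G \<subseteq> incomparable_subsets X A"
  using assms by (auto simp: cross_sperner_def incomparable_subsets_def)

lemma cross_sperner_sum_bound:
  assumes "finite X" "F \<subseteq> Pow X" "G \<subseteq> Pow X" "cross_sperner F G" "F \<noteq> {}" "G \<noteq> {}"
  defines "n \<equiv> card X"
  shows "card F + card G + 2 ^ (n div 2) + 2 ^ (n - n div 2) \<le> 2 ^ n + 2"
    and "n \<noteq> 3 \<Longrightarrow> card F + card G + 2 ^ (n div 2) + 2 ^ (n - n div 2) = 2 ^ n + 2 \<longleftrightarrow>
      (\<exists>A. A \<subseteq> X \<and> (card A = n - n div 2 \<or> card A = n div 2)
         \<and> (F = {A} \<and> G = incomparable_subsets X A \<or> G = {A} \<and> F = incomparable_subsets X A))"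
    (is "_ \<Longrightarrow> ?eq \<longleftrightarrow> ?extremal")
proof -
  have fin: "finite F" "finite G"
    using assms(1-3) by (auto intro: finite_subset[of _ "Pow X"])
  have cases: "(\<exists>A\<subseteq>X. F = {A} \<and> G \<subseteq> incomparable_subsets X A)
      \<or> (\<exists>A\<subseteq>X. G = {A} \<and> F \<subseteq> incomparable_subsets X A) \<or> (2 \<le> card F \<and> 2 \<le> card G)"
  proof (cases "card F = 1 \<or> card G = 1")
    case True
    then obtain A where "F = {A} \<or> G = {A}" by (meson card_1_singletonE)
    then show ?thesis
    proof
      assume F: "F = {A}"
      then have "A \<subseteq> X" "G \<subseteq> incomparable_subsets X A"
        using assms(2-4) by (simp_all add: cross_sperner_singleton)
      with F show ?thesis by auto
    next
      assume G: "G = {A}"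
      then have "A \<subseteq> X" "F \<subseteq> incomparable_subsets X A"
        using assms(2-4) by (simp_all add: cross_sperner_singleton cross_sperner_commute[of F])
      with G show ?thesis by auto
    qed
  next
    case False
    moreover have "card F \<noteq> 0" "card G \<noteq> 0" using assms(5,6) fin by auto
    ultimately show ?thesis by linarith
  qed
  have large: "card F + card G + 2 ^ (n div 2) + 2 ^ (n - n div 2) \<le> 2 ^ n + 2"
      "n \<noteq> 3 \<Longrightarrow> card F + card G + 2 ^ (n div 2) + 2 ^ (n - n div 2) < 2 ^ n + 2"
    if "2 \<le> card F" "2 \<le> card G"
  proof -
    have 1: "2 \<le> n" unfolding n_def using assms(1-6) by (rule cross_sperner_ground_set)
    have 2: "4 \<le> card F + card G" using that by simp
    have "card F + card G \<le> (2 ^ n :: real) / 2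
        \<or> card F + card G \<le> 2 ^ n - 2 * sqrt (2 * 2 ^ n) + 4"
      unfolding n_def using assms(1-4) that by (rule large_cross_sperner_pair)
    note large_pair_below_extremal[OF 1 2 this]
    then show "card F + card G + 2 ^ (n div 2) + 2 ^ (n - n div 2) \<le> 2 ^ n + 2"
      "n \<noteq> 3 \<Longrightarrow> card F + card G + 2 ^ (n div 2) + 2 ^ (n - n div 2) < 2 ^ n + 2"
      by auto
  qed
  note single = singleton_pair_bound[OF assms(1), folded n_def]
  show "card F + card G + 2 ^ (n div 2) + 2 ^ (n - n div 2) \<le> 2 ^ n + 2"
    using cases
  proof (elim disjE exE conjE)
    fix A assume "A \<subseteq> X" "F = {A}" "G \<subseteq> incomparable_subsets X A"
    then show ?thesis using single(1)[of A G] by simp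
  next
    fix A assume "A \<subseteq> X" "G = {A}" "F \<subseteq> incomparable_subsets X A"
    then show ?thesis using single(1)[of A F] by simp
  qed (use large in blast)
  show "?eq \<longleftrightarrow> ?extremal" if "n \<noteq> 3"
  proof
    assume ?eq
    from cases show ?extremal
    proof (elim disjE exE conjE)
      fix A assume "A \<subseteq> X" "F = {A}" "G \<subseteq> incomparable_subsets X A"
      then show ?extremal using single(2)[of A G] \<open>?eq\<close> by auto
    next
      fix A assume "A \<subseteq> X" "G = {A}" "F \<subseteq> incomparable_subsets X A"
      then show ?extremal using single(2)[of A F] \<open>?eq\<close> by auto
    next
      assume "2 \<le> card F" "2 \<le> card G"
      then show ?extremal using large(2) \<open>?eq\<close> that by simp
    qed
  next
    assume ?extremal
    then obtain A where A: "A \<subseteq> X" "card A = n - n div 2 \<or> card A = n div 2"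
      "F = {A} \<and> G = incomparable_subsets X A \<or> G = {A} \<and> F = incomparable_subsets X A"
      by blast
    then show ?eq using single(2)[of A "incomparable_subsets X A"] by auto
  qed
qed

theorem theorem7p1:
  fixes n :: nat and F G :: "nat set set"
  assumes "F \<subseteq> Pow {1..n}" and "G \<subseteq> Pow {1..n}"
    and "cross_sperner F G"
    and "F \<noteq> {}" and "G \<noteq> {}"
  shows "n \<ge> 2
    \<and> int (card F) + int (card G)
        \<le> 2 ^ n - 2 ^ nat \<lceil>real n / 2\<rceil> - 2 ^ nat \<lfloor>real n / 2\<rfloor> + 2
    \<and> (n \<noteq> 3 \<longrightarrow>
        (int (card F) + int (card G)
            = 2 ^ n - 2 ^ nat \<lceil>real n / 2\<rceil> - 2 ^ nat \<lfloor>real n / 2\<rfloor> + 2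
         \<longleftrightarrow> (\<exists>A. A \<subseteq> {1..n}
               \<and> (card A = nat \<lceil>real n / 2\<rceil> \<or> card A = nat \<lfloor>real n / 2\<rfloor>)
               \<and> (F = {A} \<and> G = incomparable_subsets {1..n} A
                  \<or> G = {A} \<and> F = incomparable_subsets {1..n} A))))"
proof -
  have fin: "finite {1..n}" and X: "card {1..n} = n" by simp_all
  have floor: "nat \<lfloor>real n / 2\<rfloor> = n div 2"
    using floor_divide_of_nat_eq[where 'a = real, of n 2] by simp
  have ceiling: "nat \<lceil>real n / 2\<rceil> = n - n div 2"
  proof -
    have "\<lceil>real n / 2\<rceil> = int (n - n div 2)" by (rule ceiling_unique) linarith+
    then show ?thesis by simp
  qed
  define k where "k = card F + card G"
  define P where "P \<longleftrightarrow> (\<exists>A. A \<subseteq> {1..n}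
      \<and> (card A = n - n div 2 \<or> card A = n div 2)
      \<and> (F = {A} \<and> G = incomparable_subsets {1..n} A
         \<or> G = {A} \<and> F = incomparable_subsets {1..n} A))"
  have n2: "n \<ge> 2"
    using cross_sperner_ground_set[OF fin assms] X by simp
  note bound = cross_sperner_sum_bound[OF fin assms, unfolded X, folded k_def P_def]
  have cast: "int (card F) + int (card G) = int k" by (simp add: k_def)
  have le: "int k \<le> 2 ^ n - 2 ^ (n - n div 2) - 2 ^ (n div 2) + 2
      \<longleftrightarrow> k + 2 ^ (n div 2) + 2 ^ (n - n div 2) \<le> 2 ^ n + 2"
    (is "_ \<longleftrightarrow> ?l \<le> ?r")
  proof -
    have "?l \<le> ?r \<longleftrightarrow> int ?l \<le> int ?r" by (rule of_nat_le_iff[symmetric])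
    then show ?thesis by (simp add: algebra_simps)
  qed
  have eq: "int k = 2 ^ n - 2 ^ (n - n div 2) - 2 ^ (n div 2) + 2
      \<longleftrightarrow> k + 2 ^ (n div 2) + 2 ^ (n - n div 2) = 2 ^ n + 2"
    (is "_ \<longleftrightarrow> ?l = ?r")
  proof -
    have "?l = ?r \<longleftrightarrow> int ?l = int ?r" by (rule of_nat_eq_iff[symmetric])
    then show ?thesis by (simp add: algebra_simps)
  qed
  show ?thesis
    unfolding floor ceiling cast le eq P_def[symmetric] using n2 bound by blast
qed

end
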